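(* For every integer $k\ge1$ there exist $1$-generic abelian tensors $T\in\mathbb{C}^{4k}\otimes\mathbb{C}^{4k}\otimes\mathbb{C}^{4k}$ that have border rank at least $\frac{k(k+1)}{6}$. In particular, there exist tensors $T\in\mathbb{C}^{4k}\otimes\mathbb{C}^{4k}\otimes\mathbb{C}^{4k}$ satisfying the Strassen-Aronhold equations with $\underline{\mathbf R}(T)\ge\frac{k(k+1)}{6}$.
   Context: All vector spaces are over $\mathbb{C}$; here $A,B,C=\mathbb{C}^m$ with $m=4k$. A tensor $T\in A\otimes B\otimes C$ is viewed as a linear map $T:A^*\to B\otimes C\simeq\mathrm{Hom}(C^*,B)$. $T$ is $1_A$-generic if some $T(\alpha)$, $\alpha\in A^*$, is invertible; $1_B$-, $1_C$-generic are defined similarly; $T$ is $1$-generic if it is $1_A$-, $1_B$- and $1_C$-generic. $T$ is $A$-concise if $T:A^*\to B\otimes C$ is injective. $T$ is ($A$-)abelian if it is $A$-concise, $1_A$-generic, and for some (equivalently every) $\alpha_0\in A^*$ with $T(\alpha_0)$ invertible, $\{T(\alpha)T(\alpha_0)^{-1}\mid\alpha\in A^*\}\subset\mathrm{End}(B)$ is a space of commuting endomorphisms. Strassen's equations for border rank $m$ express this commutativity: $[T(\alpha_1)T(\alpha)^{-1},T(\alpha_2)T(\alpha)^{-1}]=0$ for all $\alpha,\alpha_1,\alpha_2\in A^*$ with $T(\alpha)$ invertible (made polynomial by replacing $T(\alpha)^{-1}$ by the adjugate of $T(\alpha)$); for symmetric tensors they are due to Aronhold, and in that case are called the Strassen-Aronhold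 equations. The border rank $\underline{\mathbf R}(T)$ is the least $r$ such that $T$ is a limit of sums of $r$ tensors $a\otimes b\otimes c$. *)

theory Defs
  imports "HOL-Analysis.Analysis"
begin

text \<open>
  A tensor in \<open>A \<otimes> B \<otimes> C\<close> with \<open>A = B = C = \<complex>\<^sup>m\<close>, \<open>m = CARD('n)\<close>, is given by its
  coordinates \<open>T $ i $ j $ l\<close> in the standard bases, with \<open>i\<close>, \<open>j\<close>, \<open>l\<close> the indices of \<open>A\<close>, \<open>B\<close>,
  \<open>C\<close> respectively. A linear form on \<open>\<complex>\<^sup>m\<close> is given by its values on the standard basis.
\<close>

type_synonym 'n tensor = "complex ^ 'n ^ 'n ^ 'n"

text \<open>
  \<open>contr_A T\<close> is the linear map \<open>A\<^sup>* \<rightarrow> B \<otimes> C = Hom(C\<^sup>*, B)\<close>: the rows of the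
  matrix are indexed by \<open>B\<close> and the columns by \<open>C\<close>. Likewise \<open>contr_B T\<close> has values in
  \<open>A \<otimes> C\<close> and \<open>contr_C T\<close> has values in \<open>A \<otimes> B\<close>.
\<close>

definition contr_A :: "'n::finite tensor \<Rightarrow> complex ^ 'n \<Rightarrow> complex ^ 'n ^ 'n" where
  "contr_A T \<alpha> = (\<chi> j l. \<Sum>i\<in>UNIV. \<alpha> $ i * T $ i $ j $ l)"

definition contr_B :: "'n::finite tensor \<Rightarrow> complex ^ 'n \<Rightarrow> complex ^ 'n ^ 'n" where
  "contr_B T \<beta> = (\<chi> i l. \<Sum>j\<in>UNIV. \<beta> $ j * T $ i $ j $ l)"

definition contr_C :: "'n::finite tensor \<Rightarrow> complex ^ 'n \<Rightarrow> complex ^ 'n ^ 'n" where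
  "contr_C T \<gamma> = (\<chi> i j. \<Sum>l\<in>UNIV. \<gamma> $ l * T $ i $ j $ l)"

definition one_A_generic :: "'n::finite tensor \<Rightarrow> bool" where
  "one_A_generic T \<longleftrightarrow> (\<exists>\<alpha>. invertible (contr_A T \<alpha>))"

definition one_B_generic :: "'n::finite tensor \<Rightarrow> bool" where
  "one_B_generic T \<longleftrightarrow> (\<exists>\<beta>. invertible (contr_B T \<beta>))"

definition one_C_generic :: "'n::finite tensor \<Rightarrow> bool" where
  "one_C_generic T \<longleftrightarrow> (\<exists>\<gamma>. invertible (contr_C T \<gamma>))"

definition one_generic :: "'n::finite tensor \<Rightarrow> bool" where
  "one_generic T \<longleftrightarrow> one_A_generic T \<and> one_B_generic T \<and> one_C_generic T"

definition A_concise :: "'n::finite tensor \<Rightarrow> bool" where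
  "A_concise T \<longleftrightarrow> inj (contr_A T)"

definition commuting :: "complex ^ 'n ^ 'n \<Rightarrow> complex ^ 'n::finite ^ 'n \<Rightarrow> bool" where
  "commuting X Y \<longleftrightarrow> X ** Y = Y ** X"

definition abelian :: "'n::finite tensor \<Rightarrow> bool" where
  "abelian T \<longleftrightarrow> A_concise T \<and> one_A_generic T \<and>
     (\<exists>\<alpha>\<^sub>0. invertible (contr_A T \<alpha>\<^sub>0) \<and>
       (\<forall>\<alpha>\<^sub>1 \<alpha>\<^sub>2. commuting (contr_A T \<alpha>\<^sub>1 ** matrix_inv (contr_A T \<alpha>\<^sub>0))
                        (contr_A T \<alpha>\<^sub>2 ** matrix_inv (contr_A T \<alpha>\<^sub>0))))"

text \<open>
  The index type carries no order, hence no signs \<open>(-1)\<^sup>i\<^sup>+\<^sup>j\<close>; the \<open>(i, j)\<close> entry of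
  the adjugate, i.e. the \<open>(j, i)\<close> cofactor, is written as the determinant of the matrix \<open>X\<close> with
  its column \<open>i\<close> replaced by the \<open>j\<close>-th standard basis vector.
\<close>

definition adjugate :: "complex ^ 'n ^ 'n \<Rightarrow> complex ^ 'n::finite ^ 'n" where
  "adjugate X = (\<chi> i j. det (\<chi> r s. if s = i then axis j 1 $ r else X $ r $ s))"

lemma adjugate_mult: "adjugate X ** X = mat (det X)"
proof -
  have "(adjugate X ** X) $ i $ k = mat (det X) $ i $ k" for i k
  proof -
    have lin: "det (\<chi> r s. if s = i then axis j 1 $ r else X $ r $ s) * X $ j $ k =
        det (\<chi> s. if s = i then X $ j $ k *s axis j 1 else column s X)" for j
    proof -
      have "det (\<chi> r s. if s = i then axis j 1 $ r else X $ r $ s) =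
          det (transpose (\<chi> r s. if s = i then axis j 1 $ r else X $ r $ s))"
        by (simp add: det_transpose)
      also have "transpose (\<chi> r s. if s = i then axis j 1 $ r else X $ r $ s) =
          (\<chi> s. if s = i then axis j 1 else column s X)"
        by (simp add: vec_eq_iff transpose_def column_def)
      finally show ?thesis
        by (simp add: det_row_mul mult.commute)
    qed
    have "(adjugate X ** X) $ i $ k =
        (\<Sum>j\<in>UNIV. det (\<chi> s. if s = i then X $ j $ k *s axis j 1 else column s X))"
      by (simp add: matrix_matrix_mult_def adjugate_def lin)
    also have "\<dots> = det (\<chi> s. if s = i then (\<Sum>j\<in>UNIV. X $ j $ k *s axis j 1) else column s X)"
      by (simp add: det_linear_row_sum[where a = "\<lambda>_ j. X $ j $ k *s axis j 1"])
    also have "(\<Sum>j\<in>UNIV. X $ j $ k *s axis j 1) = column k X"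
      using basis_expansion[of "column k X"] by (simp add: column_def)
    also have "det (\<chi> s. if s = i then column k X else column s X) = mat (det X) $ i $ k"
    proof (cases "i = k")
      case True
      then have "(\<chi> s. if s = i then column k X else column s X) = transpose X"
        by (auto simp: vec_eq_iff transpose_def column_def)
      then show ?thesis
        using True by (simp add: det_transpose mat_def)
    next
      case False
      then have "det (\<chi> s. if s = i then column k X else column s X) = 0"
        by (intro det_identical_rows[of i k]) (auto simp: row_def vec_eq_iff)
      then show ?thesis
        using False by (simp add: mat_def)
    qed
    finally show ?thesis .
  qed
  then show ?thesis
    by (simp add: vec_eq_iff)
qed

text \<open>
  The polynomial form of Strassen's equations. The form with inverses would hold vacuously for every
  tensor that is not \<open>1\<^sub>A\<close>-generic.
\<close>

definition strassen_equations :: "'n::finite tensor \<Rightarrow> bool" where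
  "strassen_equations T \<longleftrightarrow>
     (\<forall>\<alpha> \<alpha>\<^sub>1 \<alpha>\<^sub>2. commuting (contr_A T \<alpha>\<^sub>1 ** adjugate (contr_A T \<alpha>))
                        (contr_A T \<alpha>\<^sub>2 ** adjugate (contr_A T \<alpha>)))"

definition symmetric_tensor :: "'n::finite tensor \<Rightarrow> bool" where
  "symmetric_tensor T \<longleftrightarrow>
     (\<forall>i j l. T $ i $ j $ l = T $ j $ i $ l \<and> T $ i $ j $ l = T $ i $ l $ j)"

text \<open>
  For symmetric tensors, and only for them, Strassen's equations are called the Strassen-Aronhold
  equations; symmetry is therefore part of the following predicate.
\<close>

definition strassen_aronhold :: "'n::finite tensor \<Rightarrow> bool" where
  "strassen_aronhold T \<longleftrightarrow> symmetric_tensor T \<and> strassen_equations T"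

definition rank_one :: "complex ^ 'n \<Rightarrow> complex ^ 'n \<Rightarrow> complex ^ 'n \<Rightarrow> 'n::finite tensor" where
  "rank_one a b c = (\<chi> i j l. a $ i * b $ j * c $ l)"

definition rank_le :: "nat \<Rightarrow> 'n::finite tensor set" where
  "rank_le r = {\<Sum>s<r. rank_one (a s) (b s) (c s) | a b c. True}"

definition border_rank :: "'n::finite tensor \<Rightarrow> nat" where
  "border_rank T = (LEAST r. T \<in> closure (rank_le r))"

end

(*
  Let f be a cubic form in n = 2k - 1 variables and let A be the Gorenstein algebra with Hilbert
  function (1, n, n, 1) attached to f. The trilinear form "socle coordinate of a b c" on A is a
  symmetric tensor T of size 2n + 2 = 4k. It is 1-generic because A has a unit, and abelian and a
  solution of Strassen's equations because A is commutative and associative. The coordinates of f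
  are coordinates of T. There are n(n+1)(n+2)/6 of them, and on tensors of rank at most r they are
  polynomials in 3rn parameters. If 18r < (n+1)(n+2) they therefore satisfy a polynomial relation,
  which a suitable f violates, so T has border rank greater than r.
*)

theory Submission
  imports Defs "HOL-Library.Multiset"
begin

section \<open>Algebraic dependence by counting monomials\<close>

text \<open>Gaussian elimination by induction on the equations: unless equation \<open>s0\<close> is
  trivial on \<open>T\<close>, one unknown \<open>t0\<close> is eliminated with it, and both counts
  drop by one.\<close>

lemma underdetermined_system:
  fixes A :: "'s \<Rightarrow> 't \<Rightarrow> 'a::field"
  assumes "finite S" "finite T" "card S < card T"
  shows "\<exists>x. (\<exists>t\<in>T. x t \<noteq> 0) \<and> (\<forall>s\<in>S. (\<Sum>t\<in>T. A s t * x t) = 0)"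
  using assms
proof (induction S arbitrary: T A rule: finite_induct)
  case empty
  then have "T \<noteq> {}" by auto
  then show ?case by (intro exI[of _ "\<lambda>_. 1"]) auto
next
  case (insert s0 S)
  show ?case
  proof (cases "\<forall>t\<in>T. A s0 t = 0")
    case True
    obtain x where "\<exists>t\<in>T. x t \<noteq> 0" "\<forall>s\<in>S. (\<Sum>t\<in>T. A s t * x t) = 0"
      using insert.IH[of T A] insert.prems insert.hyps by auto
    with True show ?thesis by (intro exI[of _ x]) auto
  next
    case False
    then obtain t0 where t0: "t0 \<in> T" "A s0 t0 \<noteq> 0" by auto
    define U where "U = T - {t0}"
    have U: "finite U" "t0 \<notin> U" "T = insert t0 U" "card S < card U"
      using insert.prems insert.hyps t0 by (auto simp: U_def)
    obtain y where y: "\<exists>t\<in>U. y t \<noteq> 0"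
      "\<forall>s\<in>S. (\<Sum>t\<in>U. (A s t - A s t0 * A s0 t / A s0 t0) * y t) = 0"
      using insert.IH[of U "\<lambda>s t. A s t - A s t0 * A s0 t / A s0 t0"] U by auto
    \<comment> \<open>Equation \<open>s0\<close> forces this value of the eliminated
      unknown.\<close>
    define c where "c = - (\<Sum>t\<in>U. A s0 t * y t) / A s0 t0"
    have sum_T: "(\<Sum>t\<in>T. A s t * (y(t0 := c)) t) = A s t0 * c + (\<Sum>t\<in>U. A s t * y t)" for s
    proof -
      have "(\<Sum>t\<in>U. A s t * (y(t0 := c)) t) = (\<Sum>t\<in>U. A s t * y t)"
        using U(2) by (intro sum.cong) auto
      then show ?thesis using U by simp
    qed
    have "(\<Sum>t\<in>T. A s t * (y(t0 := c)) t) = 0" if "s \<in> insert s0 S" for s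
    proof (cases "s = s0")
      case True
      then show ?thesis using t0 by (simp only: sum_T) (simp add: c_def)
    next
      case False
      then have "s \<in> S" using that by simp
      then have "(\<Sum>t\<in>U. A s t * y t) = A s t0 * (\<Sum>t\<in>U. A s0 t * y t) / A s0 t0"
        using y(2) by (simp add: left_diff_distrib sum_subtractf sum_distrib_left sum_divide_distrib mult.assoc)
      then show ?thesis by (simp only: sum_T) (simp add: c_def)
    qed
    moreover have "\<exists>t\<in>T. (y(t0 := c)) t \<noteq> 0"
      using y(1) U by auto
    ultimately show ?thesis by blast
  qed
qed

text \<open>\<open>D\<close> bounds the degree in each variable separately, so the monomials form a
  product set with \<open>(D + 1) ^ card V\<close> elements.\<close>

definition polys :: "'v set \<Rightarrow> nat \<Rightarrow> (('v \<Rightarrow> complex) \<Rightarrow> complex) set" where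
  "polys V D = {g. \<exists>c. \<forall>v. g v = (\<Sum>s\<in>V \<rightarrow>\<^sub>E {..D}. c s * (\<Prod>x\<in>V. v x ^ s x))}"

lemma polys_sum:
  assumes "\<And>i. i \<in> I \<Longrightarrow> g i \<in> polys V D"
  shows "(\<lambda>v. \<Sum>i\<in>I. g i v) \<in> polys V D"
proof -
  have "\<forall>i\<in>I. \<exists>c. \<forall>v. g i v = (\<Sum>s\<in>V \<rightarrow>\<^sub>E {..D}. c s * (\<Prod>x\<in>V. v x ^ s x))"
    using assms by (simp add: polys_def)
  from bchoice[OF this] obtain c
    where c: "\<And>i v. i \<in> I \<Longrightarrow> g i v = (\<Sum>s\<in>V \<rightarrow>\<^sub>E {..D}. c i s * (\<Prod>x\<in>V. v x ^ s x))"
    by blast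
  have "(\<Sum>i\<in>I. g i v) = (\<Sum>s\<in>V \<rightarrow>\<^sub>E {..D}. (\<Sum>i\<in>I. c i s) * (\<Prod>x\<in>V. v x ^ s x))" for v
    by (simp add: c sum_distrib_right) (rule sum.swap)
  then show ?thesis unfolding polys_def mem_Collect_eq by (intro exI[of _ "\<lambda>s. \<Sum>i\<in>I. c i s"]) auto
qed

lemma polys_scale:
  assumes "g \<in> polys V D"
  shows "(\<lambda>v. a * g v) \<in> polys V D"
proof -
  obtain c where c: "\<And>v. g v = (\<Sum>s\<in>V \<rightarrow>\<^sub>E {..D}. c s * (\<Prod>x\<in>V. v x ^ s x))"
    using assms unfolding polys_def by auto
  have "a * g v = (\<Sum>s\<in>V \<rightarrow>\<^sub>E {..D}. (a * c s) * (\<Prod>x\<in>V. v x ^ s x))" for v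
    by (simp add: c sum_distrib_left mult.assoc)
  then show ?thesis unfolding polys_def mem_Collect_eq by (intro exI[of _ "\<lambda>s. a * c s"]) auto
qed

lemma polys_monomial:
  assumes "finite V" "\<And>x. x \<in> V \<Longrightarrow> s x \<le> D"
  shows "(\<lambda>v. \<Prod>x\<in>V. v x ^ s x) \<in> polys V D"
proof -
  have fin: "finite (V \<rightarrow>\<^sub>E {..D})" using assms by (intro finite_PiE) auto
  \<comment> \<open>Elements of the extensional product are fixed outside \<open>V\<close>, so
    \<open>s\<close> is normalised there.\<close>
  have mem: "restrict s V \<in> V \<rightarrow>\<^sub>E {..D}" using assms by auto
  have "(\<Prod>x\<in>V. v x ^ s x) =
      (\<Sum>t\<in>V \<rightarrow>\<^sub>E {..D}. of_bool (t = restrict s V) * (\<Prod>x\<in>V. v x ^ t x))" for v :: "'a \<Rightarrow> complex"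
  proof -
    have "(\<Sum>t\<in>V \<rightarrow>\<^sub>E {..D}. of_bool (t = restrict s V) * (\<Prod>x\<in>V. v x ^ t x)) =
       (\<Sum>t\<in>V \<rightarrow>\<^sub>E {..D}. if t = restrict s V then (\<Prod>x\<in>V. v x ^ t x) else 0)"
      by (intro sum.cong) auto
    then show ?thesis using fin mem by simp
  qed
  then show ?thesis unfolding polys_def mem_Collect_eq
    by (intro exI[of _ "\<lambda>t. of_bool (t = restrict s V)"]) auto
qed

lemma polys_mono:
  assumes "g \<in> polys V D" "D \<le> D'" "finite V"
  shows "g \<in> polys V D'"
proof -
  obtain c where c: "\<And>v. g v = (\<Sum>s\<in>V \<rightarrow>\<^sub>E {..D}. c s * (\<Prod>x\<in>V. v x ^ s x))"
    using assms unfolding polys_def by auto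
  have "(\<lambda>v. \<Sum>s\<in>V \<rightarrow>\<^sub>E {..D}. c s * (\<Prod>x\<in>V. v x ^ s x)) \<in> polys V D'"
    using assms by (intro polys_sum polys_scale polys_monomial) (auto dest: PiE_mem intro: order_trans)
  then show ?thesis using c by presburger
qed

lemma polys_mult:
  assumes "g \<in> polys V D" "h \<in> polys V D'" "finite V"
  shows "(\<lambda>v. g v * h v) \<in> polys V (D + D')"
proof -
  obtain c where c: "\<And>v. g v = (\<Sum>s\<in>V \<rightarrow>\<^sub>E {..D}. c s * (\<Prod>x\<in>V. v x ^ s x))"
    using assms unfolding polys_def by auto
  obtain d where d: "\<And>v. h v = (\<Sum>s\<in>V \<rightarrow>\<^sub>E {..D'}. d s * (\<Prod>x\<in>V. v x ^ s x))"
    using assms unfolding polys_def by auto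
  have "g v * h v = (\<Sum>s\<in>V \<rightarrow>\<^sub>E {..D}. \<Sum>t\<in>V \<rightarrow>\<^sub>E {..D'}. c s * (d t * (\<Prod>x\<in>V. v x ^ (s x + t x))))" for v
    by (simp add: c d sum_product power_add prod.distrib mult_ac)
  moreover have "(\<lambda>v. \<Sum>s\<in>V \<rightarrow>\<^sub>E {..D}. \<Sum>t\<in>V \<rightarrow>\<^sub>E {..D'}. c s * (d t * (\<Prod>x\<in>V. v x ^ (s x + t x))))
      \<in> polys V (D + D')"
    using assms(3) by (intro polys_sum polys_scale polys_monomial) (auto intro!: add_mono dest: PiE_mem)
  ultimately show ?thesis by presburger
qed

lemma polys_one: "finite V \<Longrightarrow> (\<lambda>v. 1) \<in> polys V 0"
  using polys_monomial[of V "\<lambda>_. 0" 0] by simp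

lemma polys_var:
  assumes "finite V" "x \<in> V"
  shows "(\<lambda>v. v x) \<in> polys V 1"
proof -
  have "(\<Prod>y\<in>V. v y ^ (of_bool (y = x))) = v x" for v :: "'a \<Rightarrow> complex"
  proof -
    have "(\<Prod>y\<in>V. v y ^ (of_bool (y = x))) = (\<Prod>y\<in>V. if y = x then v y else 1)"
      by (intro prod.cong) auto
    then show ?thesis using assms by simp
  qed
  then show ?thesis using polys_monomial[of V "\<lambda>y. of_bool (y = x)" 1] assms by simp
qed

lemma polys_power:
  assumes "g \<in> polys V D" "finite V"
  shows "(\<lambda>v. g v ^ n) \<in> polys V (n * D)"
proof (induction n)
  case 0
  then show ?case using polys_one[OF assms(2)] by simp
next
  case (Suc n)
  then show ?case using polys_mult[OF assms(1) Suc assms(2)] by (simp add: add.commute)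
qed

lemma polys_prod:
  assumes "finite V" "\<And>e. e < N \<Longrightarrow> g e \<in> polys V D"
  shows "(\<lambda>v. \<Prod>e<N. g e v) \<in> polys V (N * D)"
  using assms(2)
proof (induction N)
  case 0
  then show ?case using polys_one[OF assms(1)] by simp
next
  case (Suc N)
  then have "(\<lambda>v. (\<Prod>e<N. g e v) * g N v) \<in> polys V (N * D + D)"
    by (intro polys_mult assms(1)) auto
  then show ?case by (simp add: add.commute)
qed

text \<open>
  A monomial in \<open>N\<close> variables with exponents below \<open>B\<close> is encoded by the number \<open>t < B ^ N\<close>
  whose base-\<open>B\<close> digits are the exponents.
\<close>

lemma algebraic_dependence:
  assumes "finite V" "card V < N" "\<And>e. e < N \<Longrightarrow> \<phi> e \<in> polys V D"
  shows "\<exists>B x. (\<exists>t<B ^ N. x t \<noteq> 0) \<and>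
    (\<forall>v. (\<Sum>t<B ^ N. x t * (\<Prod>e<N. \<phi> e v ^ (t div B ^ e mod B))) = 0)"
proof -
  define M where "M = card V"
  \<comment> \<open>The \<open>B ^ N\<close> products have degree at most \<open>N * (B * D)\<close>
    in each variable. As \<open>M < N\<close>, the products outnumber the monomials once
    \<open>B\<close> exceeds \<open>(D * N + 1) ^ M\<close>.\<close>
  define B where "B = Suc ((D * N + 1) ^ M)"
  define S where "S = V \<rightarrow>\<^sub>E {..N * (B * D)}"
  have S: "finite S" "card S = Suc (N * (B * D)) ^ M"
    using assms(1) by (auto simp: S_def M_def finite_PiE card_PiE)
  have "Suc (N * (B * D)) ^ M \<le> ((D * N + 1) * B) ^ M"
    by (intro power_mono) (auto simp: B_def algebra_simps)
  also have "\<dots> < B * B ^ M"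
    unfolding power_mult_distrib by (intro mult_strict_right_mono) (auto simp: B_def)
  also have "\<dots> \<le> B ^ N"
    using assms(2) power_increasing[of "Suc M" N B] by (simp add: M_def B_def)
  finally have card: "card S < card {..<B ^ N}"
    by (simp add: S)
  have "(\<lambda>v. \<Prod>e<N. \<phi> e v ^ (t div B ^ e mod B)) \<in> polys V (N * (B * D))" for t
  proof (intro polys_prod assms(1))
    fix e assume "e < N"
    moreover have "t div B ^ e mod B * D \<le> B * D"
      by (intro mult_le_mono1 less_imp_le mod_less_divisor) (simp add: B_def)
    ultimately show "(\<lambda>v. \<phi> e v ^ (t div B ^ e mod B)) \<in> polys V (B * D)"
      using polys_power[OF assms(3)] polys_mono assms(1) by blast
  qed
  then have "\<forall>t. \<exists>c. \<forall>v. (\<Prod>e<N. \<phi> e v ^ (t div B ^ e mod B)) =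
      (\<Sum>s\<in>S. c s * (\<Prod>x\<in>V. v x ^ s x))"
    by (simp add: polys_def S_def)
  from choice[OF this] obtain A where A: "\<And>t v. (\<Prod>e<N. \<phi> e v ^ (t div B ^ e mod B)) =
      (\<Sum>s\<in>S. A t s * (\<Prod>x\<in>V. v x ^ s x))"
    by blast
  obtain x where x: "\<exists>t\<in>{..<B ^ N}. x t \<noteq> 0" "\<And>s. s \<in> S \<Longrightarrow> (\<Sum>t<B ^ N. A t s * x t) = 0"
    using underdetermined_system[OF S(1) finite_lessThan card, of "\<lambda>s t. A t s"] by auto
  have "(\<Sum>t<B ^ N. x t * (\<Prod>e<N. \<phi> e v ^ (t div B ^ e mod B))) = 0" for v
  proof -
    have "(\<Sum>t<B ^ N. x t * (\<Prod>e<N. \<phi> e v ^ (t div B ^ e mod B))) =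
      (\<Sum>t<B ^ N. \<Sum>s\<in>S. A t s * x t * (\<Prod>x\<in>V. v x ^ s x))"
      by (simp add: A sum_distrib_left mult_ac)
    also have "\<dots> = (\<Sum>s\<in>S. (\<Sum>t<B ^ N. A t s * x t) * (\<Prod>x\<in>V. v x ^ s x))"
      by (subst sum.swap) (simp add: sum_distrib_right)
    finally show ?thesis using x(2) by simp
  qed
  with x(1) show ?thesis by blast
qed

text \<open>This is Kronecker substitution: putting \<open>u ^ (B ^ e)\<close> for variable
  \<open>e\<close> turns the monomial coded by \<open>t < B ^ N\<close> into \<open>u ^ t\<close>,
  so distinct monomials stay distinct.\<close>

lemma sum_digits: "(\<Sum>e<N. t div B ^ e mod B * B ^ e) = (t mod B ^ N :: nat)"
proof (induction N)
  case (Suc N)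
  then show ?case using mod_mult2_eq[of t "B ^ N" B] by (simp add: mult.commute)
qed simp

section \<open>Border rank\<close>

lemma rank_le_nth:
  "(\<Sum>s<r. rank_one (a s) (b s) (c s)) $ i $ j $ l = (\<Sum>s<r. a s $ i * b s $ j * c s $ l)"
  by (simp add: rank_one_def)

lemma rank_le_mono:
  assumes "r \<le> r'"
  shows "rank_le r \<subseteq> (rank_le r' :: 'n::finite tensor set)"
proof
  fix T :: "'n tensor" assume "T \<in> rank_le r"
  then obtain a b c where T: "T = (\<Sum>s<r. rank_one (a s) (b s) (c s))"
    by (auto simp: rank_le_def)
  \<comment> \<open>A zero first factor makes the added summands vanish.\<close>
  define a' where "a' = (\<lambda>s. if s < r then a s else 0)"
  have "(\<Sum>s<r'. rank_one (a' s) (b s) (c s)) = (\<Sum>s<r. rank_one (a' s) (b s) (c s))"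
    using assms by (intro sum.mono_neutral_right) (auto simp: a'_def rank_one_def vec_eq_iff)
  also have "\<dots> = T"
    by (simp add: T a'_def)
  finally show "T \<in> rank_le r'" by (force simp: rank_le_def)
qed

text \<open>One rank-one summand per entry suffices. This makes the \<open>LEAST\<close> in
  \<open>border_rank\<close> attained.\<close>

lemma mem_rank_le: "\<exists>r. (T :: 'n::finite tensor) \<in> rank_le r"
proof -
  obtain h where h: "bij_betw h {0..<CARD('n \<times> 'n \<times> 'n)} (UNIV :: ('n \<times> 'n \<times> 'n) set)"
    using ex_bij_betw_nat_finite[OF finite] by blast
  define r where "r = CARD('n \<times> 'n \<times> 'n)"
  have h: "bij_betw h {..<r} (UNIV :: ('n \<times> 'n \<times> 'n) set)"
    using h by (simp add: r_def atLeast0LessThan)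
  define a :: "nat \<Rightarrow> complex ^ 'n" where
    "a s = (case h s of (i, j, l) \<Rightarrow> T $ i $ j $ l *s axis i 1)" for s
  define b :: "nat \<Rightarrow> complex ^ 'n" where "b s = axis (fst (snd (h s))) 1" for s
  define c :: "nat \<Rightarrow> complex ^ 'n" where "c s = axis (snd (snd (h s))) 1" for s
  have "(\<Sum>s<r. rank_one (a s) (b s) (c s)) $ i $ j $ l = T $ i $ j $ l" for i j l
  proof -
    have "(\<Sum>s<r. rank_one (a s) (b s) (c s)) $ i $ j $ l =
       (\<Sum>s<r. (\<lambda>x. if x = (i, j, l) then T $ i $ j $ l else 0) (h s))"
      unfolding rank_le_nth
      by (intro sum.cong) (auto simp: a_def b_def c_def axis_def split: prod.split)
    also have "\<dots> = (\<Sum>x\<in>UNIV. if x = (i, j, l) then T $ i $ j $ l else 0)"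
      by (rule sum.reindex_bij_betw[OF h])
    finally show ?thesis by simp
  qed
  then have "T = (\<Sum>s<r. rank_one (a s) (b s) (c s))"
    by (simp add: vec_eq_iff)
  then show ?thesis by (force simp: rank_le_def)
qed

lemma border_rank_greater:
  assumes "T \<notin> closure (rank_le r)"
  shows "border_rank T > r"
proof (rule ccontr)
  assume "\<not> ?thesis"
  then have "rank_le (border_rank T) \<subseteq> (rank_le r :: 'a tensor set)"
    by (intro rank_le_mono) simp
  moreover have "T \<in> closure (rank_le (border_rank T))"
    unfolding border_rank_def
  proof (rule LeastI_ex)
    show "\<exists>r. T \<in> closure (rank_le r)"
      using mem_rank_le[of T] closure_subset[THEN subsetD] by blast
  qed
  ultimately show False
    using assms closure_mono by blast
qed

text \<open>
  The \<open>N\<close> coordinates are polynomials in the \<open>3 * r * card X\<close> coordinates of the factors, hence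
  satisfy a polynomial relation, which persists on the closure. The point \<open>w e = u ^ (B ^ e)\<close>
  turns the relation into a nonzero polynomial in \<open>u\<close>.
\<close>

lemma exists_coordinates_avoiding_closure:
  fixes p q z :: "nat \<Rightarrow> 'n::finite"
  assumes "\<And>e. e < N \<Longrightarrow> p e \<in> X \<and> q e \<in> X \<and> z e \<in> X"
    and card: "3 * r * card X < N"
  shows "\<exists>w. \<forall>T. (\<forall>e<N. T $ p e $ q e $ z e = w e) \<longrightarrow> T \<notin> closure (rank_le r)"
proof -
  \<comment> \<open>The parameters are factor, summand and coordinate; only coordinates in
    \<open>X\<close> enter the selected entries.\<close>
  define V where "V = {..<3::nat} \<times> {..<r} \<times> X"
  define \<phi> where "\<phi> e v = (\<Sum>s<r. v (0, s, p e) * (v (1, s, q e) * v (2, s, z e)))"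
    for e and v :: "nat \<times> nat \<times> 'n \<Rightarrow> complex"
  have V: "finite V" "card V < N"
    using card by (auto simp: V_def card_cartesian_product mult.assoc)
  have "\<phi> e \<in> polys V (1 + (1 + 1))" if "e < N" for e
    unfolding \<phi>_def using assms(1)[OF that]
    by (intro polys_sum polys_mult polys_var V) (auto simp: V_def)
  then obtain B x where x: "\<exists>t<B ^ N. x t \<noteq> 0"
    and rel: "\<And>v. (\<Sum>t<B ^ N. x t * (\<Prod>e<N. \<phi> e v ^ (t div B ^ e mod B))) = 0"
    using algebraic_dependence[OF V, of \<phi>] by blast
  define Q where "Q T = (\<Sum>t<B ^ N. x t * (\<Prod>e<N. (T $ p e $ q e $ z e) ^ (t div B ^ e mod B)))"
    for T :: "'n tensor"
  have "rank_le r \<subseteq> {T. Q T = 0}"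
  proof
    fix T :: "'n tensor" assume "T \<in> rank_le r"
    then obtain a b c where T: "T = (\<Sum>s<r. rank_one (a s) (b s) (c s))"
      by (auto simp: rank_le_def)
    define v where "v y = (case y of (m::nat, s, i) \<Rightarrow>
      (if m = 0 then a s else if m = 1 then b s else c s) $ i)" for y
    have "T $ p e $ q e $ z e = \<phi> e v" for e
      unfolding T rank_le_nth by (simp add: \<phi>_def v_def mult.assoc)
    then show "T \<in> {T. Q T = 0}"
      using rel[of v] by (simp add: Q_def)
  qed
  moreover have "closed {T. Q T = 0}"
    unfolding Q_def by (intro closed_Collect_eq continuous_intros)
  ultimately have Q0: "Q T = 0" if "T \<in> closure (rank_le r)" for T
    using closure_minimal that by blast
  have "\<exists>u::complex. (\<Sum>t<B ^ N. x t * u ^ t) \<noteq> 0"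
  proof (rule ccontr)
    assume "\<not> ?thesis"
    \<comment> \<open>A zero top coefficient is added to match the range of
      \<open>polyfun_eq_0\<close>.\<close>
    then have *: "\<forall>u. (\<Sum>t\<le>B ^ N. (if t < B ^ N then x t else 0) * u ^ t) = 0"
      by (simp add: lessThan_Suc_atMost[symmetric])
    have "x t = 0" if "t < B ^ N" for t
      using *[unfolded polyfun_eq_0, rule_format, of t] that by simp
    then show False using x by blast
  qed
  then obtain u where u: "(\<Sum>t<B ^ N. x t * u ^ t) \<noteq> 0" by blast
  have "T \<notin> closure (rank_le r)" if "\<forall>e<N. T $ p e $ q e $ z e = u ^ (B ^ e)" for T
  proof -
    have "(\<Prod>e<N. (T $ p e $ q e $ z e) ^ (t div B ^ e mod B)) = u ^ t" if "t < B ^ N" for t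
    proof -
      have "(\<Prod>e<N. (T $ p e $ q e $ z e) ^ (t div B ^ e mod B)) = 
          (\<Prod>e<N. u ^ (t div B ^ e mod B * B ^ e))"
        using \<open>\<forall>e<N. T $ p e $ q e $ z e = u ^ (B ^ e)\<close>
        by (intro prod.cong) (auto simp: power_mult[symmetric] mult.commute)
      also have "\<dots> = u ^ t"
        using that by (simp add: power_sum[symmetric] sum_digits)
      finally show ?thesis .
    qed
    then have "Q T = (\<Sum>t<B ^ N. x t * u ^ t)"
      by (simp add: Q_def)
    then show ?thesis using Q0 u by force
  qed
  then show ?thesis by (intro exI[of _ "\<lambda>e. u ^ (B ^ e)"]) blast
qed

section \<open>The Gorenstein algebra of a cubic form\<close>

lemma matrix_inv_mult:
  fixes X :: "complex ^ 'n ^ 'n::finite"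
  assumes "invertible X"
  shows "X ** matrix_inv X = mat 1" "matrix_inv X ** X = mat 1"
  using someI_ex[OF assms[unfolded invertible_def]] by (simp_all add: matrix_inv_def)

lemma adjugate_eq_matrix_inv:
  assumes "invertible X"
  shows "adjugate X = mat (det X) ** matrix_inv X"
  using adjugate_mult[of X] matrix_inv_mult(1)[OF assms]
  by (metis matrix_mul_assoc matrix_mul_rid)

lemma mat_mult_commute: "mat c ** X = X ** mat (c :: complex)"
proof -
  have "(\<Sum>k\<in>UNIV. (if i = k then c else 0) * X $ k $ j) = (\<Sum>k\<in>UNIV. if k = i then c * X $ i $ j else 0)"
    "(\<Sum>k\<in>UNIV. X $ i $ k * (if k = j then c else 0)) = (\<Sum>k\<in>UNIV. if k = j then c * X $ i $ j else 0)" for i j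
    by (rule sum.cong, simp, simp)+
  then show ?thesis
    by (simp add: vec_eq_iff matrix_matrix_mult_def mat_def)
qed

lemma continuous_on_det:
  fixes A :: "'t::topological_space \<Rightarrow> complex ^ 'n ^ 'n::finite"
  assumes "\<And>i j. continuous_on U (\<lambda>t. A t $ i $ j)"
  shows "continuous_on U (\<lambda>t. det (A t))"
  unfolding det_def by (intro continuous_intros assms)

lemma continuous_on_adjugate:
  fixes A :: "'t::topological_space \<Rightarrow> complex ^ 'n ^ 'n::finite"
  assumes "\<And>i j. continuous_on U (\<lambda>t. A t $ i $ j)"
  shows "continuous_on U (\<lambda>t. adjugate (A t) $ i $ j)"
  unfolding adjugate_def vec_lambda_beta
proof (rule continuous_on_det)
  fix k l
  show "continuous_on U (\<lambda>t. (\<chi> r s. if s = i then axis j 1 $ r else A t $ r $ s) $ k $ l)"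
    by (cases "l = i") (auto intro: assms)
qed

text \<open>
  The tensor \<open>G\<close> is \<open>(a, b, c) \<mapsto> \<ell>(a b c)\<close> on the graded algebra with Hilbert function
  \<open>(1, n, n, 1)\<close> and \<open>n = card X\<close>. Its basis consists of the unit \<open>e\<close>, the variables
  \<open>X\<close>, their duals \<open>\<sigma> ` X\<close> and the socle generator \<open>\<sigma> e\<close>, and \<open>\<ell>\<close> is the socle
  coordinate; \<open>f\<close> is the cubic form.
\<close>

locale cubic_algebra =
  fixes e :: "'n::finite" and \<sigma> :: "'n \<Rightarrow> 'n" and X :: "'n set"
    and f :: "'n \<Rightarrow> 'n \<Rightarrow> 'n \<Rightarrow> complex"
  assumes invol [simp]: "\<sigma> (\<sigma> i) = i"
    and e_neq [simp]: "\<sigma> e \<noteq> e" "e \<noteq> \<sigma> e"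
    and X_e [simp]: "e \<notin> X" "\<sigma> e \<notin> X"
    and X_disj: "i \<in> X \<Longrightarrow> \<sigma> i \<notin> X"
    and cover: "i \<in> X \<or> \<sigma> i \<in> X \<or> i = e \<or> i = \<sigma> e"
    and f_sym: "f i j l = f j i l" "f i j l = f i l j"
begin

definition G :: "'n tensor" where
  "G = (\<chi> i j l. if i = e then of_bool (l = \<sigma> j) else if j = e then of_bool (l = \<sigma> i)
     else if l = e then of_bool (j = \<sigma> i)
     else if i \<in> X \<and> j \<in> X \<and> l \<in> X then f i j l else 0)"

text \<open>The Gram matrix of the pairing sending (a, b) to the socle coordinate of a b.\<close>

definition J :: "complex ^ 'n ^ 'n" where
  "J = (\<chi> j l. of_bool (l = \<sigma> j))"

section \<open>Symmetry of the tensor, and the pairing given by the unit\<close>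

lemma \<sigma>_eq: "\<sigma> i = \<sigma> j \<longleftrightarrow> i = j" "\<sigma> i = e \<longleftrightarrow> i = \<sigma> e"
  using invol by metis+

lemma G_swap: "G $ i $ j $ l = G $ j $ i $ l" "G $ i $ j $ l = G $ i $ l $ j"
proof -
  have "f i j l = f j i l" "f i j l = f i l j" by (rule f_sym)+
  moreover have "j = \<sigma> i \<longleftrightarrow> i = \<sigma> j" "j = \<sigma> l \<longleftrightarrow> l = \<sigma> j" "i = \<sigma> l \<longleftrightarrow> l = \<sigma> i"
    using invol by metis+
  ultimately show "G $ i $ j $ l = G $ j $ i $ l" "G $ i $ j $ l = G $ i $ l $ j"
    by (auto simp: G_def)
qed

lemma G_symmetric: "symmetric_tensor G"
  using G_swap by (auto simp: symmetric_tensor_def)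

lemma G_X:
  assumes "i \<in> X" "j \<in> X" "l \<in> X"
  shows "G $ i $ j $ l = f i j l"
proof -
  have "i \<noteq> e" "j \<noteq> e" "l \<noteq> e" using assms X_e(1) by metis+
  then show ?thesis using assms by (simp add: G_def)
qed

lemma G_e: "G $ e $ j $ l = of_bool (l = \<sigma> j)"
  by (simp add: G_def)

lemma G_e2: "G $ i $ e $ l = of_bool (l = \<sigma> i)"
  using G_swap(1)[of i e l] by (simp add: G_e)

lemma contr_e: "contr_A G (axis e 1) = J"
proof -
  have "axis e 1 $ i * G $ i $ j $ l = (if i = e then of_bool (l = \<sigma> j) else 0)" for i j l
    by (simp add: axis_def G_e)
  then show ?thesis
    by (simp add: contr_A_def J_def vec_eq_iff)
qed

lemma J_mult: "(J ** M) $ i $ j = M $ \<sigma> i $ j"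
proof -
  have "of_bool (k = \<sigma> i) * M $ k $ j = (if k = \<sigma> i then M $ k $ j else 0)" for k
    by simp
  then show ?thesis by (simp add: matrix_matrix_mult_def J_def)
qed

lemma JJ [simp]: "J ** J = mat 1"
  by (auto simp: vec_eq_iff J_mult) (auto simp: J_def mat_def)

lemma J_invertible: "invertible J"
  unfolding invertible_def using JJ by blast

lemma J_inv: "matrix_inv J = J"
  using matrix_inv_mult[OF J_invertible] JJ by (metis matrix_mul_assoc matrix_mul_lid matrix_mul_rid)

text \<open>The socle coordinate of (i j)(i' l): since \<open>p\<close> and
  \<open>\<sigma> p\<close> are dual basis elements, i j has coefficient
  \<open>G $ i $ j $ p\<close> at \<open>\<sigma> p\<close>.\<close>

definition S :: "'n \<Rightarrow> 'n \<Rightarrow> 'n \<Rightarrow> 'n \<Rightarrow> complex" where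
  "S i j i' l = (\<Sum>p\<in>UNIV. G $ i $ j $ p * G $ i' $ \<sigma> p $ l)"

lemma S_e1: "S e j i' l = G $ i' $ j $ l"
proof -
  have "S e j i' l = (\<Sum>p\<in>UNIV. if p = \<sigma> j then G $ i' $ \<sigma> p $ l else 0)"
    unfolding S_def G_e by (intro sum.cong) auto
  then show ?thesis by simp
qed

lemma S_swap: "S i j i' l = S j i i' l" "S i j i' l = S i' l i j"
proof -
  show "S i j i' l = S j i i' l"
    unfolding S_def using G_swap(1)[of i j] by simp
  have "S i j i' l = (\<Sum>p\<in>UNIV. G $ i $ j $ \<sigma> p * G $ i' $ \<sigma> (\<sigma> p) $ l)"
    unfolding S_def
    by (rule sum.reindex_bij_witness[of _ \<sigma> \<sigma>]) auto
  also have "\<dots> = S i' l i j"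
    unfolding S_def using G_swap(2)[of i j] G_swap(2)[of i' _ l] by (simp add: mult.commute)
  finally show "S i j i' l = S i' l i j" .
qed

lemma S_e: "S i e i' l = G $ i' $ i $ l" "S i j e l = G $ i $ l $ j" "S i j i' e = G $ i $ i' $ j"
  using S_swap S_e1 by metis+

text \<open>The four factors have positive degree, so their product has degree at least 4, above the
  socle. In coordinates, nonzero factors would put both \<open>p\<close> and
  \<open>\<sigma> p\<close> in \<open>insert e X\<close>, which is impossible.\<close>

lemma S_zero:
  assumes "i \<noteq> e" "j \<noteq> e" "i' \<noteq> e" "l \<noteq> e"
  shows "S i j i' l = 0"
proof -
  have "G $ i $ j $ p * G $ i' $ \<sigma> p $ l = 0" for p
  proof -
    have "\<sigma> p \<noteq> e \<or> p = \<sigma> e" using invol by metis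
    moreover have "p \<notin> X" if "\<sigma> p = e" using X_e that invol by metis
    ultimately show ?thesis using assms X_disj[of p] by (auto simp: G_def)
  qed
  then show ?thesis unfolding S_def by (simp only: sum.neutral_const)
qed

text \<open>Associativity of the algebra: with a unit among the factors it is the symmetry of
  \<open>G\<close>, and otherwise both sides vanish.\<close>

lemma S_assoc: "S i j i' l = S i' j i l"
proof -
  consider "i = e" | "j = e" | "i' = e" | "l = e" | "i \<noteq> e" "j \<noteq> e" "i' \<noteq> e" "l \<noteq> e"
    by blast
  then show ?thesis
  proof cases
    case 1
    then show ?thesis by (simp only: S_e1 S_e(2)) (rule G_swap)
  next
    case 2
    then show ?thesis by (simp only: S_e(1)) (rule G_swap)
  next
    case 3
    then show ?thesis by (simp only: S_e1 S_e(2)) (rule G_swap)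
  next
    case 4
    then show ?thesis by (simp only: S_e(3)) (rule G_swap)
  next
    case 5
    then show ?thesis by (simp add: S_zero)
  qed
qed

text \<open>As \<open>J\<close> is the inverse of the pairing, inserting it between two contractions
  composes the multiplications by \<open>\<alpha>\<close> and \<open>\<beta>\<close>.\<close>

lemma contr_J_contr:
  "(contr_A G \<alpha> ** (J ** contr_A G \<beta>)) $ j $ l = (\<Sum>i\<in>UNIV. \<Sum>i'\<in>UNIV. \<alpha> $ i * \<beta> $ i' * S i j i' l)"
proof -
  have "(contr_A G \<alpha> ** (J ** contr_A G \<beta>)) $ j $ l =
      (\<Sum>p\<in>UNIV. (contr_A G \<alpha>) $ j $ p * (contr_A G \<beta>) $ \<sigma> p $ l)"
    by (subst matrix_matrix_mult_def) (simp add: J_mult)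
  also have "\<dots> = (\<Sum>p\<in>UNIV. \<Sum>i\<in>UNIV. \<Sum>i'\<in>UNIV. \<alpha> $ i * \<beta> $ i' * (G $ i $ j $ p * G $ i' $ \<sigma> p $ l))"
    by (simp add: contr_A_def sum_product mult_ac)
  also have "\<dots> = (\<Sum>i\<in>UNIV. \<Sum>p\<in>UNIV. \<Sum>i'\<in>UNIV. \<alpha> $ i * \<beta> $ i' * (G $ i $ j $ p * G $ i' $ \<sigma> p $ l))"
    by (rule sum.swap)
  also have "\<dots> = (\<Sum>i\<in>UNIV. \<Sum>i'\<in>UNIV. \<Sum>p\<in>UNIV. \<alpha> $ i * \<beta> $ i' * (G $ i $ j $ p * G $ i' $ \<sigma> p $ l))"
    by (intro sum.cong refl sum.swap)
  finally show ?thesis by (simp add: S_def sum_distrib_left)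
qed

lemma contr_commute: "contr_A G \<alpha> ** (J ** contr_A G \<beta>) = contr_A G \<beta> ** (J ** contr_A G \<alpha>)"
proof -
  have "(contr_A G \<alpha> ** (J ** contr_A G \<beta>)) $ j $ l = (contr_A G \<beta> ** (J ** contr_A G \<alpha>)) $ j $ l" for j l
    unfolding contr_J_contr
  proof (subst sum.swap, intro sum.cong refl)
    fix i i'
    show "\<alpha> $ i' * \<beta> $ i * S i' j i l = \<beta> $ i * \<alpha> $ i' * S i j i' l"
      using S_assoc[of i' j i l] by simp
  qed
  then show ?thesis by (simp add: vec_eq_iff)
qed

text \<open>Multiplication by \<open>\<alpha>\<close> is determined by its value at the unit: row
  \<open>e\<close> lists the coordinates of \<open>\<alpha>\<close>, permuted by
  \<open>\<sigma>\<close>.\<close>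

lemma G_concise: "A_concise G"
  unfolding A_concise_def
proof (rule injI)
  have row: "contr_A G \<alpha> $ e $ \<sigma> i = \<alpha> $ i" for \<alpha> i
  proof -
    have "contr_A G \<alpha> $ e $ \<sigma> i = (\<Sum>k\<in>UNIV. if k = i then \<alpha> $ k else 0)"
      unfolding contr_A_def vec_lambda_beta by (intro sum.cong) (auto simp: G_e2 \<sigma>_eq)
    then show ?thesis by simp
  qed
  fix \<alpha> \<beta> assume "contr_A G \<alpha> = contr_A G \<beta>"
  then show "\<alpha> = \<beta>" unfolding vec_eq_iff[of \<alpha> \<beta>] using row by metis
qed

lemma G_one_generic: "one_generic G"
proof -
  have "contr_B G = contr_A G" "contr_C G = contr_A G"
    unfolding contr_A_def contr_B_def contr_C_def
    using G_swap by (auto simp: fun_eq_iff vec_eq_iff intro!: sum.cong)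
  moreover have "invertible (contr_A G (axis e 1))"
    by (simp add: contr_e J_invertible)
  ultimately show ?thesis
    unfolding one_generic_def one_A_generic_def one_B_generic_def one_C_generic_def by auto
qed

text \<open>Taking the unit as base point makes the inverse equal to \<open>J\<close>, so that
  \<open>contr_commute\<close> applies directly.\<close>

lemma G_abelian: "abelian G"
  unfolding abelian_def
proof (intro conjI exI allI)
  show "A_concise G" by (rule G_concise)
  show "one_A_generic G" using G_one_generic by (simp add: one_generic_def)
  show "invertible (contr_A G (axis e 1))" by (simp add: contr_e J_invertible)
  fix \<alpha> \<beta>
  show "commuting (contr_A G \<alpha> ** matrix_inv (contr_A G (axis e 1)))
     (contr_A G \<beta> ** matrix_inv (contr_A G (axis e 1)))"
  proof -
    have "(contr_A G \<alpha> ** J) ** (contr_A G \<beta> ** J) = contr_A G \<alpha> ** (J ** contr_A G \<beta>) ** J" for \<alpha> \<beta>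
      by (simp only: matrix_mul_assoc)
    then show ?thesis
      unfolding contr_e J_inv commuting_def by (simp only: contr_commute[of \<alpha> \<beta>])
  qed
qed

text \<open>An element with nonzero constant term is a unit of this local algebra. The kernel is
  shown trivial by a triangular argument: the coordinates of \<open>v\<close> vanish in order of
  increasing degree.\<close>

lemma contr_invertible:
  assumes "\<alpha> $ e \<noteq> 0"
  shows "invertible (contr_A G \<alpha>)"
proof -
  have "v = 0" if "contr_A G \<alpha> *v v = 0" for v
  proof -
    have eq: "(\<Sum>j\<in>UNIV. \<Sum>i\<in>UNIV. \<alpha> $ i * G $ i $ l $ j * v $ j) = 0" for l
    proof -
      have "(contr_A G \<alpha> *v v) $ l = 0" using that by simp
      then show ?thesis
        by (simp add: matrix_vector_mult_def contr_A_def sum_distrib_right)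
    qed
    \<comment> \<open>Row \<open>\<sigma> j\<close> reduces to \<open>\<alpha> $ e * v $ j\<close>
      once its other terms are known to vanish.\<close>
    have single: "v $ j = 0"
      if "\<And>i j'. i \<noteq> e \<or> j' \<noteq> j \<Longrightarrow> G $ i $ l $ j' * v $ j' = 0" and "l = \<sigma> j" for l j
    proof -
      have "\<alpha> $ i * G $ i $ l $ j' * v $ j' = (if i = e then if j' = j then \<alpha> $ e * v $ j else 0 else 0)" for i j'
        using that(1)[of i j'] that(2) by (auto simp: G_e)
      then have "(\<Sum>i\<in>UNIV. \<alpha> $ i * G $ i $ l $ j' * v $ j') = (if j' = j then \<alpha> $ e * v $ j else 0)" for j'
        by (simp only: sum.delta finite UNIV_I if_True)
      then have "(\<Sum>j'\<in>UNIV. \<Sum>i\<in>UNIV. \<alpha> $ i * G $ i $ l $ j' * v $ j') = \<alpha> $ e * v $ j"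
        by (simp only: sum.delta finite UNIV_I if_True)
      then show ?thesis using eq[of l] assms by simp
    qed
    have v0: "v $ e = 0"
      by (rule single[of e "\<sigma> e"]) (auto simp: G_def \<sigma>_eq)
    have v1: "v $ x = 0" if "x \<in> X" for x
      using that v0 X_disj[OF that]
      by (intro single[of x "\<sigma> x"]) (auto simp: G_def \<sigma>_eq)
    have v2: "v $ \<sigma> x = 0" if "x \<in> X" for x
      using that v0 v1 X_disj[OF that]
      by (intro single[of "\<sigma> x" x]) (auto simp: G_def \<sigma>_eq)
    have v3: "v $ \<sigma> e = 0"
    proof (rule single[of "\<sigma> e" e])
      fix i j' assume "i \<noteq> e \<or> j' \<noteq> \<sigma> e"
      moreover have "v $ j' = 0" if "j' \<noteq> \<sigma> e"
        using cover[of j'] v0 v1 v2[of "\<sigma> j'"] that by auto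
      ultimately show "G $ i $ e $ j' * v $ j' = 0"
        by (auto simp: G_e2 \<sigma>_eq)
    qed simp
    show ?thesis
      unfolding vec_eq_iff using cover v0 v1 v2 v3 by (metis invol zero_index)
  qed
  then show ?thesis
    by (simp add: invertible_left_inverse matrix_left_invertible_ker)
qed

text \<open>Commutativity passes from the unit to any base point with invertible contraction, by
  moving \<open>J\<close> across \<open>P \<delta>\<close>.\<close>

lemma strassen_commuting_invertible:
  assumes "invertible (contr_A G \<alpha>)"
  shows "commuting (contr_A G \<beta> ** adjugate (contr_A G \<alpha>)) (contr_A G \<gamma> ** adjugate (contr_A G \<alpha>))"
proof -
  define M where "M = contr_A G \<alpha>"
  define M' where "M' = matrix_inv M"
  define d :: "complex ^ 'n ^ 'n" where "d = mat (det M)"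
  define P where "P \<delta> = contr_A G \<delta> ** M'" for \<delta>
  have M': "M ** M' = mat 1" "M' ** M = mat 1"
    using assms by (simp_all add: M'_def M_def matrix_inv_mult)
  have JP: "J ** P \<delta> = M' ** (contr_A G \<delta> ** J)" for \<delta>
  proof -
    have "M' ** (M ** (J ** contr_A G \<delta>)) ** M' = M' ** (contr_A G \<delta> ** (J ** M)) ** M'"
      using contr_commute[of \<alpha> \<delta>] by (simp add: M_def)
    then have "(M' ** M) ** (J ** contr_A G \<delta>) ** M' = M' ** contr_A G \<delta> ** J ** (M ** M')"
      by (simp only: matrix_mul_assoc)
    then show ?thesis by (simp add: M' P_def matrix_mul_assoc)
  qed
  \<comment> \<open>By \<open>JP\<close>, each side is a product of the form in
    \<open>contr_commute\<close>, enclosed between two copies of \<open>M'\<close>.\<close>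
  have "J ** (P \<beta> ** P \<gamma>) = J ** (P \<gamma> ** P \<beta>)"
  proof -
    have "J ** (P \<delta> ** P \<epsilon>) = M' ** (contr_A G \<delta> ** (J ** contr_A G \<epsilon>)) ** M'" for \<delta> \<epsilon>
      using JP[of \<delta>] by (simp only: matrix_mul_assoc) (simp only: P_def matrix_mul_assoc)
    then show ?thesis using contr_commute by metis
  qed
  then have PP: "P \<beta> ** P \<gamma> = P \<gamma> ** P \<beta>"
    by (metis JJ matrix_mul_assoc matrix_mul_lid)
  have dX: "d ** X = X ** d" for X
    unfolding d_def by (rule mat_mult_commute)
  \<comment> \<open>The adjugate differs from the inverse by the central matrix
    \<open>d\<close>.\<close>
  have "contr_A G \<delta> ** adjugate M = d ** P \<delta>" for \<delta>
    using adjugate_eq_matrix_inv[of M] assms dX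
    by (simp add: M_def[symmetric] d_def[symmetric] M'_def[symmetric] P_def)
      (metis matrix_mul_assoc)
  moreover have "(d ** P \<beta>) ** (d ** P \<gamma>) = (d ** P \<gamma>) ** (d ** P \<beta>)"
    using PP dX by (metis matrix_mul_assoc)
  ultimately show ?thesis
    by (simp add: commuting_def M_def)
qed

text \<open>
  Every \<open>\<alpha>\<close> is a limit of points \<open>\<alpha> + t e\<close> at which the contraction is invertible.
\<close>

lemma G_strassen: "strassen_equations G"
  unfolding strassen_equations_def
proof (intro allI)
  fix \<alpha> \<beta> \<gamma> :: "complex ^ 'n"
  define M where "M t = contr_A G (\<alpha> + t *s axis e 1)" for t
  define L where "L \<beta> \<gamma> t = (contr_A G \<beta> ** adjugate (M t)) ** (contr_A G \<gamma> ** adjugate (M t))" for \<beta> \<gamma> t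
  have "continuous_on UNIV (\<lambda>t. M t $ i $ j)" for i j
    unfolding M_def contr_A_def by (auto intro!: continuous_intros)
  then have adj: "continuous_on UNIV (\<lambda>t. adjugate (M t) $ i $ j)" for i j
    by (rule continuous_on_adjugate)
  have cont: "continuous_on UNIV (\<lambda>t. L \<beta> \<gamma> t $ i $ j)" for \<beta> \<gamma> i j
    unfolding L_def matrix_matrix_mult_def vec_lambda_beta
    by (intro continuous_on_sum continuous_on_mult continuous_on_const adj)
  have eq: "L \<beta> \<gamma> t = L \<gamma> \<beta> t" if "t \<noteq> - \<alpha> $ e" for t
  proof -
    have "invertible (M t)"
      unfolding M_def using that by (intro contr_invertible) (simp add: axis_def add_eq_0_iff)
    then show ?thesis
      unfolding L_def M_def using strassen_commuting_invertible by (auto simp: commuting_def)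
  qed
  have "L \<beta> \<gamma> 0 $ i $ j = L \<gamma> \<beta> 0 $ i $ j" for i j
  proof -
    have lim: "((\<lambda>t. L \<beta> \<gamma> t $ i $ j) \<longlongrightarrow> L \<beta> \<gamma> 0 $ i $ j) (at 0)" for \<beta> \<gamma>
      using cont[of \<beta> \<gamma> i j] by (simp add: continuous_on_def)
    \<comment> \<open>The single excluded \<open>t\<close> is either 0 or at positive distance from
      0, so a punctured neighbourhood of 0 avoids it.\<close>
    have "eventually (\<lambda>t. L \<beta> \<gamma> t $ i $ j = L \<gamma> \<beta> t $ i $ j) (at 0)"
      by (rule eventually_mono[OF eventually_neq_at_within[of "- \<alpha> $ e"]]) (simp add: eq)
    then have "((\<lambda>t. L \<gamma> \<beta> t $ i $ j) \<longlongrightarrow> L \<beta> \<gamma> 0 $ i $ j) (at 0)"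
      using lim[of \<beta> \<gamma>] by (rule Lim_transform_eventually[rotated])
    then show ?thesis
      using lim[of \<gamma> \<beta>] by (rule tendsto_unique[OF at_neq_bot])
  qed
  then have "L \<beta> \<gamma> 0 = L \<gamma> \<beta> 0" by (simp add: vec_eq_iff)
  then show "commuting (contr_A G \<beta> ** adjugate (contr_A G \<alpha>)) (contr_A G \<gamma> ** adjugate (contr_A G \<alpha>))"
    by (simp add: L_def M_def commuting_def)
qed

end

section \<open>Generic cubic forms\<close>

text \<open>Sorted triples index the cubic monomials in \<open>n\<close> variables, whose number is
  the binomial coefficient n + 2 over 3.\<close>

lemma card_sorted_triples:
  "6 * card (SIGMA l:{..<n}. SIGMA j:{..l}. {..j::nat}) = n * (n + 1) * (n + 2)"
proof -
  have inner: "2 * (\<Sum>j\<le>l. Suc j) = (l + 1) * (l + 2)" for l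
    by (induction l) auto
  have "6 * (\<Sum>l<n. \<Sum>j\<le>l. Suc j) = n * (n + 1) * (n + 2)"
  proof (induction n)
    case (Suc n)
    then show ?case using inner[of n] by (simp add: algebra_simps)
  qed simp
  then show ?thesis by simp
qed

text \<open>Indexing coefficients by multisets builds in the symmetry. One coordinate per sorted
  triple gives coordinates that a symmetric form can take independently.\<close>

lemma exists_generic_cubic:
  fixes X :: "'n::finite set"
  assumes "18 * r < (card X + 1) * (card X + 2)" "X \<noteq> {}"
  shows "\<exists>F :: 'n multiset \<Rightarrow> complex. \<forall>T.
    (\<forall>i\<in>X. \<forall>j\<in>X. \<forall>l\<in>X. T $ i $ j $ l = F {#i, j, l#}) \<longrightarrow> T \<notin> closure (rank_le r)"
proof -
  define n where "n = card X"
  obtain h where h: "bij_betw h {..<n} X"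
    using ex_bij_betw_nat_finite[of X] by (auto simp: n_def atLeast0LessThan)
  define E where "E = (SIGMA l:{..<n}. SIGMA j:{..l}. {..j::nat})"
  have finE: "finite E" by (auto simp: E_def)
  define N where "N = card E"
  obtain g where g: "bij_betw g {..<N} E"
    using ex_bij_betw_nat_finite[OF finE] by (auto simp: N_def atLeast0LessThan)
  define q where "q m = h (fst (g m))" for m
  define p where "p m = h (fst (snd (g m)))" for m
  define z where "z m = h (snd (snd (g m)))" for m
  have g_E: "g m \<in> E" if "m < N" for m
    using g that by (auto dest: bij_betwE)
  have in_X: "p m \<in> X \<and> q m \<in> X \<and> z m \<in> X" if "m < N" for m
    using g_E[OF that] bij_betwE[OF h] by (auto simp: E_def p_def q_def z_def)
  \<comment> \<open>Divided by 6, this is the bound \<open>3 * r * n < N\<close> on the number of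
    parameters.\<close>
  have "18 * r * n < n * (n + 1) * (n + 2)"
    using mult_strict_right_mono[OF assms(1), of n] assms(2)
    by (simp add: n_def card_gt_0_iff algebra_simps)
  then have "3 * r * card X < N"
    using card_sorted_triples[of n] by (simp add: N_def E_def n_def)
  from exists_coordinates_avoiding_closure[of N p X q z, OF in_X this]
  obtain w where w: "\<And>T. (\<forall>m<N. T $ p m $ q m $ z m = w m) \<Longrightarrow> T \<notin> closure (rank_le r)"
    by blast
  define k where "k m = {#p m, q m, z m#}" for m
  \<comment> \<open>A sorted list is determined by its multiset, so the values \<open>w\<close> can
    be prescribed through \<open>F\<close> without conflict.\<close>
  have inj_k: "inj_on k {..<N}"
  proof (rule inj_onI)
    fix m m' assume m: "m \<in> {..<N}" "m' \<in> {..<N}" "k m = k m'"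
    obtain l j i l' j' i' where gm: "g m = (l, j, i)" "g m' = (l', j', i')"
      by (metis prod_cases3)
    have E: "(l, j, i) \<in> E" "(l', j', i') \<in> E"
      using g_E[of m] g_E[of m'] m gm by auto
    define h' where "h' = inv_into {..<n} h"
    have h': "h' (h y) = y" if "y < n" for y
      using that h by (simp add: h'_def bij_betw_def)
    have "image_mset h' (k m) = image_mset h' (k m')" using m by simp
    then have "mset [i, j, l] = mset [i', j', l']"
      using E by (simp add: k_def p_def q_def z_def gm h' E_def add_mset_commute)
    moreover have "sorted [i, j, l]" "sorted [i', j', l']"
      using E by (auto simp: E_def)
    ultimately have "[i, j, l] = [i', j', l']"
      by (metis properties_for_sort)
    then have "g m = g m'" by (simp add: gm)
    then show "m = m'" using g m by (auto simp: bij_betw_def inj_on_def)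
  qed
  define F where "F y = w (inv_into {..<N} k y)" for y
  have "F {#p m, q m, z m#} = w m" if "m < N" for m
    using inv_into_f_f[OF inj_k] that by (simp add: F_def k_def[symmetric])
  then show ?thesis
    using w in_X by (intro exI[of _ F]) simp
qed

text \<open>Number the indices from 0 to 4k - 1 and let \<open>\<sigma>\<close> be the reversal.
  Then 0 is the unit, 1 to 2k - 1 are the variables, 2k to 4k - 2 their duals, and 4k - 1 the
  socle.\<close>

lemma exists_cubic_structure:
  assumes "CARD('n::finite) = 4 * k" "k \<ge> 1"
  shows "\<exists>e \<sigma> X. card X = 2 * k - 1 \<and> (\<forall>f :: 'n \<Rightarrow> 'n \<Rightarrow> 'n \<Rightarrow> complex.
    (\<forall>i j l. f i j l = f j i l \<and> f i j l = f i l j) \<longrightarrow> cubic_algebra e \<sigma> X f)"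
proof -
  obtain b :: "'n \<Rightarrow> nat" where b: "bij_betw b UNIV {..<4 * k}"
    using ex_bij_betw_finite_nat[of "UNIV :: 'n set"] assms by (auto simp: atLeast0LessThan)
  define c where "c = inv b"
  have bc: "b (c m) = m" if "m < 4 * k" for m
    using b that by (auto simp: c_def bij_betw_def f_inv_into_f)
  have cb: "c (b i) = i" for i
    using b by (simp add: c_def bij_betw_def)
  have lt: "b i < 4 * k" for i using bij_betwE[OF b] by auto
  define \<sigma> where "\<sigma> i = c (4 * k - 1 - b i)" for i
  have b\<sigma>: "b (\<sigma> i) = 4 * k - 1 - b i" for i
    using assms by (simp add: \<sigma>_def bc)
  define X where "X = c ` {1..2 * k - 1}"
  have X: "i \<in> X \<longleftrightarrow> 1 \<le> b i \<and> b i \<le> 2 * k - 1" for i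
  proof
    assume "i \<in> X"
    then show "1 \<le> b i \<and> b i \<le> 2 * k - 1"
      using assms by (auto simp: X_def bc)
  next
    assume "1 \<le> b i \<and> b i \<le> 2 * k - 1"
    then show "i \<in> X" unfolding X_def by (intro image_eqI[of _ _ "b i"]) (auto simp: cb)
  qed
  have b_eq: "i = j \<longleftrightarrow> b i = b j" for i j by (metis cb)
  have be: "b (c 0) = 0" using assms by (simp add: bc)
  have "inj_on c {1..2 * k - 1}"
    using bc assms by (intro inj_on_inverseI[of _ b]) auto
  then have "card X = 2 * k - 1" by (simp add: X_def card_image)
  moreover have "cubic_algebra (c 0) \<sigma> X f" if "\<forall>i j l. f i j l = f j i l \<and> f i j l = f i l j"
    for f :: "'n \<Rightarrow> 'n \<Rightarrow> 'n \<Rightarrow> complex"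
  proof
    fix i j l
    show "f i j l = f j i l" "f i j l = f i l j" using that by blast+
    show "\<sigma> (\<sigma> i) = i" using lt[of i] by (simp add: b_eq b\<sigma>)
    show "\<sigma> (c 0) \<noteq> c 0" "c 0 \<noteq> \<sigma> (c 0)"
      using assms(2) by (simp_all add: b_eq b\<sigma> be)
    show "c 0 \<notin> X" "\<sigma> (c 0) \<notin> X" 
      using assms(2) by (auto simp: X b\<sigma> be)
    show "\<sigma> i \<notin> X" if "i \<in> X" using that lt[of i] by (auto simp: X b\<sigma>)
    show "i \<in> X \<or> \<sigma> i \<in> X \<or> i = c 0 \<or> i = \<sigma> (c 0)"
      unfolding b_eq[of i] X b\<sigma> be using lt[of i] by linarith
  qed
  ultimately show ?thesis by blast
qed

theorem proposition5p9:
  fixes k :: nat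
  assumes "k \<ge> 1" and "CARD('n::finite) = 4 * k"
  shows "(\<exists>T :: 'n tensor. one_generic T \<and> abelian T \<and>
            real (border_rank T) \<ge> real k * (real k + 1) / 6) \<and>
         (\<exists>T :: 'n tensor. strassen_aronhold T \<and>
            real (border_rank T) \<ge> real k * (real k + 1) / 6)"
proof -
  obtain e :: 'n and \<sigma> X where card_X: "card X = 2 * k - 1"
    and alg: "\<And>f. \<forall>i j l. f i j l = f j i l \<and> f i j l = f i l j \<Longrightarrow> cubic_algebra e \<sigma> X f"
    using exists_cubic_structure[OF assms(2,1)] by metis
  \<comment> \<open>The largest \<open>r\<close> with \<open>6 * r < k * (k + 1)\<close>, so border
    rank above \<open>r\<close> is exactly the claimed bound.\<close>
  define r where "r = (k * (k + 1) - 1) div 6"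
  have "6 * r < k * (k + 1)" using assms(1) by (simp add: r_def)
  then have "18 * r < 3 * (k * (k + 1))" by simp
  \<comment> \<open>The right side is 2k(2k + 1), which exceeds 3k(k + 1) by k^2 - k.\<close>
  also have "\<dots> \<le> (card X + 1) * (card X + 2)"
  proof -
    have "k \<le> k * k" using assms(1) by simp
    moreover have "card X + 1 = 2 * k" "card X + 2 = 2 * k + 1" using card_X assms(1) by auto
    ultimately show ?thesis by (simp only:) (simp add: algebra_simps)
  qed
  finally have "18 * r < (card X + 1) * (card X + 2)" .
  moreover have "X \<noteq> {}" using card_X assms(1) by auto
  ultimately obtain F :: "'n multiset \<Rightarrow> complex" where F: "\<And>T.
    \<forall>i\<in>X. \<forall>j\<in>X. \<forall>l\<in>X. T $ i $ j $ l = F {#i, j, l#} \<Longrightarrow> T \<notin> closure (rank_le r)"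
    using exists_generic_cubic by blast
  interpret cubic_algebra e \<sigma> X "\<lambda>i j l. F {#i, j, l#}"
    by (rule alg) (simp add: add_mset_commute)
  have "border_rank G > r"
    by (intro border_rank_greater F) (simp add: G_X)
  then have "k * (k + 1) \<le> 6 * border_rank G"
    unfolding r_def by linarith
  then have "real (k * (k + 1)) \<le> real (6 * border_rank G)"
    by (rule of_nat_mono)
  then have "real (border_rank G) \<ge> real k * (real k + 1) / 6"
    by (simp add: algebra_simps)
  \<comment> \<open>The same \<open>G\<close> witnesses both claims.\<close>
  then show ?thesis
    using G_one_generic G_abelian G_symmetric G_strassen
    unfolding strassen_aronhold_def by blast
qed

end
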